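(* Let $A$ be any algorithm with the following properties: $A$ is given $N$, an accuracy parameter $\epsilon>0$, a value $0<a_{\max}\in\mathbb{Z}$, and access to i.i.d. draws from a distribution $\mathbf{S}'=(a_2\mathbf{S}_2\bmod a_3)$ where $\mathbf{S}_2$ is a PBD$_N$, $a_3$ is the largest prime that is at most $a_{\max}$, and $a_2\in\{1,\dots,a_3-1\}$ is unknown to $A$. Suppose that $A$ is guaranteed to output a hypothesis distribution $\tilde{\mathbf{S}}'$ satisfying $\mathbb{E}[d_{TV}(\mathbf{S}',\tilde{\mathbf{S}}')]\le\epsilon$ (expectation over the samples and any internal randomness of $A$). Then for sufficiently large $N$, $A$ must use $\Omega(\log a_{\max})$ samples when run with $\epsilon$ set to some sufficiently small absolute constant.
   Context: A PBD$_N$ is a sum of $N$ mutually independent (not necessarily identical) Bernoulli random variables. $d_{TV}$ denotes total variation distance. *)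

theory Defs
  imports "HOL-Probability.Probability" "HOL-Computational_Algebra.Primes"
begin

text \<open>Poisson binomial distribution PBD_N: law of X_0 + ... + X_(N-1), the X_i independent
  Bernoulli with success probabilities p i (assumed in [0,1]).\<close>
fun pbd :: "(nat \<Rightarrow> real) \<Rightarrow> nat \<Rightarrow> nat pmf" where
  "pbd p 0 = return_pmf 0"
| "pbd p (Suc n) =
     bind_pmf (pbd p n) (\<lambda>s. bind_pmf (bernoulli_pmf (p n)) (\<lambda>b. return_pmf (s + of_bool b)))"

fun iid_samples :: "nat \<Rightarrow> 'a pmf \<Rightarrow> 'a list pmf" where
  "iid_samples 0 D = return_pmf []"
| "iid_samples (Suc m) D =
     bind_pmf D (\<lambda>x. bind_pmf (iid_samples m D) (\<lambda>xs. return_pmf (x # xs)))"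

definition dTV :: "'a pmf \<Rightarrow> 'a pmf \<Rightarrow> real" where
  "dTV P Q = (SUP A. \<bar>measure_pmf.prob P A - measure_pmf.prob Q A\<bar>)"

definition largest_prime_le :: "nat \<Rightarrow> nat" where
  "largest_prime_le a = (GREATEST p. prime p \<and> p \<le> a)"

end

theory Submission
  imports Defs "HOL-Real_Asymp.Real_Asymp" "HOL-Number_Theory.Cong"
begin

text \<open>
  Let \<open>q\<close> be the largest prime up to \<open>a_max\<close>, and choose \<open>n\<close> such that \<open>x = cos (\<pi>/q)^n\<close> lies in
  \<open>[1/4, 1/2]\<close>. The Fourier coefficient of \<open>Bin(n, 1/2) mod q\<close> at the frequency \<open>j\<close> has modulus
  \<open>|cos (\<pi> j/q)|^n\<close>. As \<open>cos (j \<theta>) \<le> (cos \<theta>)^j\<close>, these moduli sum to at most 3, so every dilate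
  \<open>D_a\<close> of the binomial law by \<open>a\<close> is pointwise at most 3 times the uniform law on the residues. If
  \<open>a \<noteq> \<plusminus> b\<close>, then at the frequency \<open>1/a\<close> the coefficient of \<open>D_a\<close> has modulus \<open>x\<close>, whereas that of
  \<open>D_b\<close> has modulus at most \<open>x^4\<close> because \<open>cos (2 \<theta>) \<le> (cos \<theta>)^4\<close>; hence the \<open>D_a\<close> with
  \<open>1 \<le> a < q/2\<close> are pairwise separated by an absolute constant.

  A learner with small expected error identifies \<open>a\<close> with probability at least 1/2. The
  identification events are disjoint, and the law of the \<open>m\<close> samples is at most \<open>3^m\<close> times the
  uniform one, so \<open>(q - 1)/4 \<le> 3^m\<close> up to rounding. Finally \<open>q \<ge> sqrt a_max\<close> follows from
  \<open>2^(n - 2) \<le> Lcm {1..n} \<le> n^q\<close> with \<open>n = a_max\<close>.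
\<close>

section \<open>A lower bound for the largest prime below a number\<close>

text \<open>The integral of \<open>(x (1 - x))^k\<close> over \<open>[0, 1]\<close> is positive and at most \<open>4^-k\<close>, and it becomes an
  integer when multiplied by \<open>Lcm {1..2 k + 1}\<close>.\<close>

lemma Lcm_atLeastAtMost_lower_bound:
  fixes k :: nat
  shows "4 ^ k \<le> Lcm {1..2 * k + 1}"
proof -
  define L where "L = Lcm {1..2 * k + 1}"
  define f where "f = (\<lambda>x::real. (x * (1 - x)) ^ k)"
  \<comment> \<open>\<open>I\<close> is the termwise integral of the binomial expansion of
    \<open>f\<close>. Its denominators lie between \<open>k + 1\<close> and
    \<open>2 * k + 1\<close>, so each of them divides \<open>L\<close>.\<close>
  define I where "I = (\<Sum>i\<le>k. of_nat (k choose i) * (- 1) ^ i / real (k + i + 1))"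
  have f_sum: "f x = (\<Sum>i\<le>k. of_nat (k choose i) * (- 1) ^ i * x ^ (k + i))" for x
  proof -
    have "(1 - x) ^ k = (- x + 1) ^ k" by simp
    also have "\<dots> = (\<Sum>i\<le>k. of_nat (k choose i) * (- x) ^ i)"
      by (subst binomial_ring) simp
    finally have "f x = x ^ k * (\<Sum>i\<le>k. of_nat (k choose i) * (- x) ^ i)"
      by (simp add: f_def power_mult_distrib)
    also have "\<dots> = (\<Sum>i\<le>k. of_nat (k choose i) * (- 1) ^ i * x ^ (k + i))"
      unfolding sum_distrib_left
      by (intro sum.cong refl) (simp add: power_add power_minus[of x] mult_ac)
    finally show ?thesis .
  qed
  have "((\<lambda>x. x ^ j) has_integral 1 / real (j + 1)) {0..1}" for j :: nat
  proof -
    have "((\<lambda>x. x ^ j) has_integral (1 ^ (j + 1) / real (j + 1) - 0 ^ (j + 1) / real (j + 1))) {0..1}"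
      by (intro fundamental_theorem_of_calculus)
         (auto intro!: derivative_eq_intros simp: has_real_derivative_iff_has_vector_derivative[symmetric]
            simp del: power_Suc)
    thus ?thesis by simp
  qed
  note monomial = this
  have "((\<lambda>x. of_nat (k choose i) * (- 1) ^ i * x ^ (k + i)) has_integral
      of_nat (k choose i) * (- 1) ^ i / real (k + i + 1)) {0..1}" for i
    using has_integral_mult_right[OF monomial[of "k + i"], of "of_nat (k choose i) * (- 1) ^ i"]
    by simp
  hence f_int: "(f has_integral I) {0..1}"
    unfolding f_sum I_def by (intro has_integral_sum) auto
  have f_le: "f x \<le> (1/4) ^ k" if "x \<in> {0..1}" for x
  proof -
    have "x * (1 - x) \<le> 1/4"
      using zero_le_power2[of "x - 1/2"] by (simp add: power2_eq_square algebra_simps)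
    thus ?thesis unfolding f_def using that by (intro power_mono) auto
  qed
  have "I \<le> (1/4) ^ k"
    using has_integral_le[OF f_int has_integral_const_real[of "(1/4) ^ k" 0 1]] f_le by simp
  moreover have "I > 0"
  proof -
    have "I \<ge> 0" using has_integral_nonneg[OF f_int] by (auto simp: f_def)
    moreover have "I \<noteq> 0"
    proof
      assume "I = 0"
      hence "integral {0..1} f = 0" using f_int by auto
      moreover have "continuous_on {0..1} f" unfolding f_def by (intro continuous_intros)
      moreover have "f x \<ge> 0" if "x \<in> {0..1}" for x using that by (auto simp: f_def)
      ultimately have "\<forall>x\<in>{0..1}. f x = 0"
        by (subst (asm) Equivalence_Lebesgue_Henstock_Integration.integral_eq_0_iff) auto
      hence "f (1/2) = 0" by (rule bspec) simp
      thus False by (simp add: f_def)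
    qed
    ultimately show ?thesis by simp
  qed
  moreover have "real L * I \<in> \<int>"
  proof -
    have "real L * (of_nat (k choose i) * (- 1) ^ i / real (k + i + 1)) \<in> \<int>" if "i \<le> k" for i
    proof -
      have "k + i + 1 dvd L" unfolding L_def using that by (intro dvd_Lcm) auto
      then obtain r where r: "L = (k + i + 1) * r" by (elim dvdE)
      have "real L * (of_nat (k choose i) * (- 1) ^ i / real (k + i + 1))
          = real r * (of_nat (k choose i) * (- 1) ^ i)"
        unfolding r by (simp add: field_simps)
      thus ?thesis by simp
    qed
    thus ?thesis unfolding I_def sum_distrib_left by (intro Ints_sum) auto
  qed
  moreover have "L > 0" unfolding L_def by (rule Nat.gr0I) (simp add: Lcm_0_iff)
  ultimately have "real L * I \<ge> 1"
    by (metis Ints_nonzero_abs_ge1 abs_of_pos less_numeral_extra(3) mult_pos_pos of_nat_0_less_iff)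
  also have "real L * I \<le> real L * (1/4) ^ k"
    using \<open>I \<le> (1/4) ^ k\<close> by (intro mult_left_mono) auto
  finally have "4 ^ k \<le> real L" by (simp add: field_simps)
  thus ?thesis unfolding L_def by (metis of_nat_le_iff of_nat_numeral of_nat_power)
qed

text \<open>The multiplicity of \<open>p\<close> in an lcm is the larger of the two multiplicities.
  Primality matters: 6 divides \<open>lcm 2 3\<close>.\<close>

lemma prime_power_dvd_lcmD:
  fixes p a b :: nat
  assumes "prime p" "p ^ e dvd lcm a b" "a \<noteq> 0" "b \<noteq> 0"
  shows "p ^ e dvd a \<or> p ^ e dvd b"
proof -
  have "e \<le> multiplicity p (lcm a b)"
    using assms by (intro multiplicity_geI) (auto simp: lcm_eq_0_iff)
  also have "\<dots> = max (multiplicity p a) (multiplicity p b)"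
    using assms by (intro multiplicity_lcm)  auto
  finally show ?thesis by (auto simp: max_def multiplicity_dvd' split: if_splits)
qed

text \<open>Splitting off the last entry of the lcm at each step, the prime power ends up dividing a
  single number between 1 and \<open>n\<close>.\<close>

lemma prime_power_dvd_Lcm_le:
  fixes p n :: nat
  assumes "prime p" "p ^ e dvd Lcm {1..n}" "n \<ge> 1"
  shows "p ^ e \<le> n"
  using assms(2,3)
proof (induction n)
  case (Suc n)
  show ?case
  proof (cases "n = 0")
    case True
    thus ?thesis using Suc.prems by auto
  next
    case False
    have "{1..Suc n} = insert (Suc n) {1..n}" by auto
    hence "p ^ e dvd lcm (Suc n) (Lcm {1..n})" using Suc.prems by simp
    moreover have "Lcm {1..n} \<noteq> 0" by (simp add: Lcm_0_iff)
    ultimately have "p ^ e dvd Suc n \<or> p ^ e dvd Lcm {1..n}"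
      using assms(1) by (intro prime_power_dvd_lcmD) auto
    thus ?thesis using Suc.IH False by (auto dest: dvd_imp_le)
  qed
qed auto

lemma largest_prime_le_props:
  assumes "n \<ge> 2"
  shows "prime (largest_prime_le n)" "largest_prime_le n \<le> n"
    "\<And>p. prime p \<Longrightarrow> p \<le> n \<Longrightarrow> p \<le> largest_prime_le n"
proof -
  have "prime (largest_prime_le n) \<and> largest_prime_le n \<le> n"
    unfolding largest_prime_le_def
    by (rule GreatestI_nat[where k = 2 and b = n]) (use assms in auto)
  thus "prime (largest_prime_le n)" "largest_prime_le n \<le> n" by auto
  show "p \<le> largest_prime_le n" if "prime p" "p \<le> n" for p
    unfolding largest_prime_le_def
    by (rule Greatest_le_nat[where b = n]) (use that in auto)
qed

text \<open>Every prime power in the factorisation of the lcm is at most \<open>n\<close>, and the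
  number of its primes is crudely bounded by the largest one.\<close>

lemma Lcm_atLeastAtMost_upper_bound:
  assumes "n \<ge> 2"
  shows "Lcm {1..n} \<le> n ^ largest_prime_le n"
proof -
  let ?L = "Lcm {1..n}"
  have "?L \<noteq> 0" by (simp add: Lcm_0_iff)
  hence "?L = (\<Prod>p\<in>prime_factors ?L. p ^ multiplicity p ?L)"
    by (intro prime_factorization_nat) (simp only: neq0_conv)
  also have "\<dots> \<le> (\<Prod>p\<in>prime_factors ?L. n)"
    using assms by (intro prod_mono conjI prime_power_dvd_Lcm_le multiplicity_dvd) auto
  also have "\<dots> = n ^ card (prime_factors ?L)" by simp
  also have "\<dots> \<le> n ^ largest_prime_le n"
  proof (rule power_increasing)
    have "prime_factors ?L \<subseteq> {1..largest_prime_le n}"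
    proof
      fix p assume p: "p \<in> prime_factors ?L"
      hence "prime p" "p ^ 1 dvd ?L" by auto
      hence "p \<le> n" using prime_power_dvd_Lcm_le[of p 1 n] assms by simp
      thus "p \<in> {1..largest_prime_le n}"
        using \<open>prime p\<close> largest_prime_le_props[OF assms] prime_ge_1_nat by auto
    qed
    from card_mono[OF _ this] show "card (prime_factors ?L) \<le> largest_prime_le n" by simp
  qed (use assms in auto)
  finally show ?thesis .
qed

text \<open>Comparing the two bounds on the lcm gives a prime of order at least
  \<open>n / ln n\<close>. The weaker \<open>sqrt n\<close> suffices, as it costs only a factor 2 in
  the logarithm.\<close>

lemma eventually_sqrt_le_largest_prime_le:
  "\<forall>\<^sub>F n in sequentially. sqrt (real n) \<le> real (largest_prime_le n)"
proof -
  have "\<forall>\<^sub>F n::nat in sequentially. sqrt (real n) * ln (real n) \<le> (real n - 2) * ln 2"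
    by real_asymp
  thus ?thesis using eventually_ge_at_top[of 2]
  proof eventually_elim
    case (elim n)
    \<comment> \<open>This is the largest \<open>k\<close> with \<open>2 * k + 1 \<le> n\<close>, so
      that \<open>2 * k\<close> is \<open>n - 1\<close> or \<open>n - 2\<close>.\<close>
    define k where "k = (n - 1) div 2"
    have "(2::nat) ^ (n - 2) \<le> 2 ^ (2 * k)" by (intro power_increasing) (auto simp: k_def)
    also have "\<dots> = 4 ^ k" by (simp add: power_mult)
    also have "\<dots> \<le> Lcm {1..2 * k + 1}" by (rule Lcm_atLeastAtMost_lower_bound)
    also have "\<dots> \<le> Lcm {1..n}"
      using elim by (intro dvd_imp_le Lcm_subset) (auto simp: k_def Lcm_0_iff intro!: Nat.gr0I)
    also have "\<dots> \<le> n ^ largest_prime_le n" using elim by (intro Lcm_atLeastAtMost_upper_bound)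
    finally have "real (2 ^ (n - 2)) \<le> real (n ^ largest_prime_le n)" by (simp only: of_nat_le_iff)
    hence "ln (2 ^ (n - 2)) \<le> ln (real n ^ largest_prime_le n)"
      using elim by (subst ln_le_cancel_iff) auto
    hence "real (n - 2) * ln 2 \<le> real (largest_prime_le n) * ln (real n)"
      using elim by (simp add: ln_realpow)
    with elim have "sqrt (real n) * ln (real n) \<le> real (largest_prime_le n) * ln (real n)"
      unfolding of_nat_diff[OF elim(2)] of_nat_numeral by linarith
    moreover have "ln (real n) > 0" using elim by simp
    ultimately show ?case by (rule mult_right_le_imp_le)
  qed
qed

section \<open>Total variation distance and separated families\<close>

lemma bdd_above_dTV:
  "bdd_above (range (\<lambda>A. \<bar>measure_pmf.prob P A - measure_pmf.prob Q A\<bar>))"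
proof (rule bdd_aboveI2)
  show "\<bar>measure_pmf.prob P A - measure_pmf.prob Q A\<bar> \<le> 1" for A
    using measure_pmf.prob_le_1[of P A] measure_pmf.prob_le_1[of Q A]
      measure_nonneg[of P A] measure_nonneg[of Q A] by linarith
qed

lemma abs_prob_diff_le_dTV: "\<bar>measure_pmf.prob P A - measure_pmf.prob Q A\<bar> \<le> dTV P Q"
  unfolding dTV_def by (rule cSUP_upper[OF _ bdd_above_dTV]) simp

lemma dTV_le: "(\<And>A. \<bar>measure_pmf.prob P A - measure_pmf.prob Q A\<bar> \<le> c) \<Longrightarrow> dTV P Q \<le> c"
  unfolding dTV_def by (rule cSUP_least) auto

lemma dTV_nonneg: "0 \<le> dTV P Q"
  using abs_prob_diff_le_dTV[of P "{}" Q] by simp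

lemma dTV_le_1: "dTV P Q \<le> 1"
proof (rule dTV_le)
  show "\<bar>measure_pmf.prob P A - measure_pmf.prob Q A\<bar> \<le> 1" for A
    using measure_pmf.prob_le_1[of P A] measure_pmf.prob_le_1[of Q A]
      measure_nonneg[of P A] measure_nonneg[of Q A] by linarith
qed

text \<open>Symmetry is built in: both distances on the right are to \<open>R\<close>, which will be
  one hypothesis close to two candidates.\<close>

lemma dTV_triangle: "dTV P Q \<le> dTV P R + dTV Q R"
proof (rule dTV_le)
  show "\<bar>measure_pmf.prob P A - measure_pmf.prob Q A\<bar> \<le> dTV P R + dTV Q R" for A
    using abs_prob_diff_le_dTV[of P A R] abs_prob_diff_le_dTV[of Q A R] by linarith
qed

text \<open>Splitting \<open>X\<close> by the sign of the difference of the masses writes the L1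
  distance as two differences of event probabilities. With characters as \<open>f\<close>, this
  bounds \<open>dTV\<close> from below.\<close>

lemma norm_expectation_diff_le_dTV:
  fixes f :: "'a \<Rightarrow> complex"
  assumes "finite X" "set_pmf P \<subseteq> X" "set_pmf Q \<subseteq> X" "\<And>x. x \<in> X \<Longrightarrow> norm (f x) \<le> 1"
  shows "norm (measure_pmf.expectation P f - measure_pmf.expectation Q f) \<le> 2 * dTV P Q"
proof -
  define A where "A = {x\<in>X. pmf P x \<ge> pmf Q x}"
  define B where "B = {x\<in>X. pmf P x < pmf Q x}"
  have AB: "finite A" "finite B" "A \<inter> B = {}" "X = A \<union> B"
    using assms(1) by (auto simp: A_def B_def)
  have "measure_pmf.expectation P f - measure_pmf.expectation Q f
      = (\<Sum>x\<in>X. (pmf P x - pmf Q x) *\<^sub>R f x)"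
    using assms by (subst (1 2) integral_measure_pmf[of X])
      (auto simp: sum_subtractf[symmetric] scaleR_diff_left)
  also have "norm \<dots> \<le> (\<Sum>x\<in>X. \<bar>pmf P x - pmf Q x\<bar>)"
    using assms(4) by (intro sum_norm_le) (auto intro!: mult_left_le)
  also have "\<dots> = (\<Sum>x\<in>A. \<bar>pmf P x - pmf Q x\<bar>) + (\<Sum>x\<in>B. \<bar>pmf P x - pmf Q x\<bar>)"
    unfolding AB(4) using AB(1-3) by (rule sum.union_disjoint)
  also have "(\<Sum>x\<in>A. \<bar>pmf P x - pmf Q x\<bar>) = (\<Sum>x\<in>A. pmf P x - pmf Q x)"
    by (intro sum.cong) (auto simp: A_def)
  also have "\<dots> = measure_pmf.prob P A - measure_pmf.prob Q A"
    using AB by (simp add: sum_subtractf measure_measure_pmf_finite)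
  also have "(\<Sum>x\<in>B. \<bar>pmf P x - pmf Q x\<bar>) = (\<Sum>x\<in>B. pmf Q x - pmf P x)"
    by (intro sum.cong) (auto simp: B_def)
  also have "\<dots> = measure_pmf.prob Q B - measure_pmf.prob P B"
    using AB by (simp add: sum_subtractf measure_measure_pmf_finite)
  finally show ?thesis
    using abs_prob_diff_le_dTV[of P A Q] abs_prob_diff_le_dTV[of P B Q] by linarith
qed

section \<open>Laws of samples and their domination by a reference law\<close>

lemma pmf_iid_samples_Cons:
  "pmf (iid_samples (Suc m) D) (x # xs) = pmf D x * pmf (iid_samples m D) xs"
proof -
  have "iid_samples (Suc m) D = map_pmf (\<lambda>(x, xs). x # xs) (pair_pmf D (iid_samples m D))"
    by (simp add: pair_pmf_def map_bind_pmf)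
  moreover have "inj (\<lambda>(x, xs). x # xs)" by (auto simp: inj_on_def)
  ultimately show ?thesis
    using pmf_map_inj'[of "\<lambda>(x, xs). x # xs" "pair_pmf D (iid_samples m D)" "(x, xs)"]
    by (simp add: pmf_pair del: iid_samples.simps)
qed

lemma length_iid_samples: "xs \<in> set_pmf (iid_samples m D) \<Longrightarrow> length xs = m"
  by (induction m arbitrary: xs) auto

text \<open>Likelihood ratios of independent draws multiply; lists of the wrong length have mass
  zero on both sides.\<close>

lemma pmf_iid_samples_le:
  assumes "\<And>x. pmf D x \<le> K * pmf Q x"
  shows "pmf (iid_samples m D) xs \<le> K ^ m * pmf (iid_samples m Q) xs"
proof (induction m arbitrary: xs)
  case (Suc m)
  show ?case
  proof (cases xs)
    case Nil
    hence "pmf (iid_samples (Suc m) D') xs = 0" for D' :: "'a pmf"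
      using length_iid_samples[of xs "Suc m" D'] by (auto simp: pmf_eq_0_set_pmf)
    thus ?thesis by simp
  next
    case (Cons y ys)
    have "pmf D y * pmf (iid_samples m D) ys \<le> (K * pmf Q y) * (K ^ m * pmf (iid_samples m Q) ys)"
      using assms[of y] Suc.IH[of ys] order.trans[OF pmf_nonneg assms[of y]]
      by (intro mult_mono) auto
    thus ?thesis unfolding Cons pmf_iid_samples_Cons by (simp add: mult_ac)
  qed
qed simp

text \<open>Domination survives any randomised processing of the samples, so it passes from the
  samples to the learner's output.\<close>

lemma prob_bind_pmf_le:
  assumes "\<And>x. pmf P x \<le> K * pmf Q x" "K \<ge> 0"
  shows "measure_pmf.prob (bind_pmf P A) E \<le> K * measure_pmf.prob (bind_pmf Q A) E"
proof -
  have "emeasure (bind_pmf P A) E = (\<integral>\<^sup>+x. ennreal (pmf P x) * emeasure (A x) E \<partial>count_space UNIV)"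
    by (simp add: nn_integral_measure_pmf)
  also have "\<dots> \<le> (\<integral>\<^sup>+x. ennreal K * (ennreal (pmf Q x) * emeasure (A x) E) \<partial>count_space UNIV)"
  proof (intro nn_integral_mono)
    fix x
    have "ennreal (pmf P x) \<le> ennreal K * ennreal (pmf Q x)"
      using assms by (simp add: ennreal_mult[symmetric] ennreal_leI)
    thus "ennreal (pmf P x) * emeasure (A x) E \<le> ennreal K * (ennreal (pmf Q x) * emeasure (A x) E)"
      by (simp add: mult.assoc[symmetric] mult_right_mono)
  qed
  also have "\<dots> = ennreal K * emeasure (bind_pmf Q A) E"
    by (simp add: nn_integral_cmult nn_integral_measure_pmf)
  finally show ?thesis
    using assms(2) by (simp add: measure_pmf.emeasure_eq_measure ennreal_mult[symmetric])
qed

text \<open>If every candidate law is dominated by \<open>K\<close> times a common reference law, then the events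
  of returning a hypothesis close to a given candidate are disjoint, and each has probability at
  least \<open>1 / (2 K^m)\<close> when the samples are drawn from the reference law.\<close>

lemma card_separated_family_le:
  fixes D :: "'i \<Rightarrow> 'a pmf" and A :: "'a list \<Rightarrow> 'a pmf pmf"
  assumes "finite I" "\<delta> > 0" "K \<ge> 0"
    and dominated: "\<And>i x. i \<in> I \<Longrightarrow> pmf (D i) x \<le> K * pmf Q x"
    and separated: "\<And>i j. i \<in> I \<Longrightarrow> j \<in> I \<Longrightarrow> i \<noteq> j \<Longrightarrow> dTV (D i) (D j) \<ge> \<delta>"
    and learns: "\<And>i. i \<in> I \<Longrightarrow>
      measure_pmf.expectation (bind_pmf (iid_samples m (D i)) A) (\<lambda>H. dTV (D i) H) \<le> \<delta> / 4"
  shows "real (card I) \<le> 2 * K ^ m"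
proof -
  define E where "E = (\<lambda>i. {H. dTV (D i) H < \<delta> / 2})"
  let ?R = "bind_pmf (iid_samples m Q) A"
  have half: "1 / 2 \<le> K ^ m * measure_pmf.prob ?R (E i)" if "i \<in> I" for i
  proof -
    let ?P = "bind_pmf (iid_samples m (D i)) A"
    \<comment> \<open>Markov's inequality with mean at most \<open>\<delta> / 4\<close> and
      threshold \<open>\<delta> / 2\<close>: the learner misses with probability at most
      1/2.\<close>
    have "measure_pmf.prob ?P {H \<in> space ?P. dTV (D i) H \<ge> \<delta> / 2}
        \<le> measure_pmf.expectation ?P (\<lambda>H. dTV (D i) H) / (\<delta> / 2)"
      using assms(2)
      by (intro integral_Markov_inequality_measure[where A = "{}"] measure_pmf.integrable_const_bound[where B = 1])
         (auto simp: dTV_nonneg dTV_le_1)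
    also have "\<dots> \<le> (\<delta> / 4) / (\<delta> / 2)"
      using learns[OF that] assms(2) by (intro divide_right_mono) auto
    also have "\<dots> = 1 / 2" using assms(2) by simp
    also have "{H \<in> space ?P. dTV (D i) H \<ge> \<delta> / 2} = space ?P - E i"
      by (auto simp: E_def)
    finally have "1 / 2 \<le> measure_pmf.prob ?P (E i)"
      by (subst (asm) measure_pmf.prob_compl) auto
    also have "\<dots> \<le> K ^ m * measure_pmf.prob ?R (E i)"
      using dominated[OF that] assms(3) by (intro prob_bind_pmf_le pmf_iid_samples_le) auto
    finally show ?thesis .
  qed
  have disj: "disjoint_family_on E I"
  proof (unfold disjoint_family_on_def, intro ballI impI)
    fix i j assume ij: "i \<in> I" "j \<in> I" "i \<noteq> j"
    show "E i \<inter> E j = {}"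
    proof (rule ccontr)
      assume "E i \<inter> E j \<noteq> {}"
      then obtain H where "dTV (D i) H < \<delta> / 2" "dTV (D j) H < \<delta> / 2" by (auto simp: E_def)
      thus False using separated[OF ij] dTV_triangle[of "D i" "D j" H] by linarith
    qed
  qed
  have "real (card I) / 2 = (\<Sum>i\<in>I. 1 / 2)" by simp
  also have "\<dots> \<le> (\<Sum>i\<in>I. K ^ m * measure_pmf.prob ?R (E i))"
    using half by (intro sum_mono)
  also have "\<dots> = K ^ m * measure_pmf.prob ?R (\<Union>i\<in>I. E i)"
    using disj assms(1) by (subst measure_pmf.finite_measure_finite_Union) (auto simp: sum_distrib_left)
  also have "\<dots> \<le> K ^ m * 1"
    using assms(3) by (intro mult_left_mono measure_pmf.prob_le_1) auto
  finally show ?thesis by simp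
qed

section \<open>Dilated binomial laws modulo a prime\<close>

lemma set_pmf_pbd: "set_pmf (pbd p n) \<subseteq> {..n}"
proof (induction n)
  case (Suc n)
  thus ?case by (fastforce simp: set_bind_pmf)
qed simp

text \<open>The probability generating function factorises over independent summands. At a root of
  unity \<open>z\<close> it is a Fourier coefficient.\<close>

lemma expectation_pbd_power:
  fixes z :: complex
  assumes "\<And>i. 0 \<le> p i \<and> p i \<le> 1"
  shows "measure_pmf.expectation (pbd p n) (\<lambda>s. z ^ s)
    = (\<Prod>i<n. 1 - of_real (p i) + of_real (p i) * z)"
proof (induction n)
  case (Suc n)
  have bern: "measure_pmf.expectation
      (bind_pmf (bernoulli_pmf (p n)) (\<lambda>b. return_pmf (s + of_bool b))) (\<lambda>s. z ^ s)
    = z ^ s * (1 - of_real (p n) + of_real (p n) * z)" for s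
    using assms[of n]
    by (subst pmf_expectation_bind[of UNIV]) (auto simp: UNIV_bool scaleR_conv_of_real algebra_simps)
  have "measure_pmf.expectation (pbd p (Suc n)) (\<lambda>s. z ^ s)
      = (\<Sum>s\<le>n. pmf (pbd p n) s *\<^sub>R (z ^ s * (1 - of_real (p n) + of_real (p n) * z)))"
    unfolding pbd.simps using set_pmf_pbd[of p n]
    by (subst pmf_expectation_bind[of "{..n}"]) (auto simp: bern)
  also have "\<dots> = (\<Sum>s\<le>n. pmf (pbd p n) s *\<^sub>R z ^ s) * (1 - of_real (p n) + of_real (p n) * z)"
    by (simp add: sum_distrib_right)
  also have "(\<Sum>s\<le>n. pmf (pbd p n) s *\<^sub>R z ^ s) = measure_pmf.expectation (pbd p n) (\<lambda>s. z ^ s)"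
    using set_pmf_pbd[of p n] by (subst integral_measure_pmf[of "{..n}"]) auto
  finally show ?case by (simp add: Suc.IH)
qed simp

text \<open>Taking out the half-angle factor \<open>cis (\<alpha> / 2)\<close>, of modulus 1, leaves
  a real number.\<close>

lemma norm_one_plus_cis: "norm ((1 + cis \<alpha>) / 2) = \<bar>cos (\<alpha> / 2)\<bar>"
proof -
  have "cis (\<alpha> / 2) * cis (- \<alpha> / 2) = 1" "cis (\<alpha> / 2) * cis (\<alpha> / 2) = cis \<alpha>"
    by (simp_all add: cis_mult)
  moreover have "cis (\<alpha> / 2) + cis (- \<alpha> / 2) = of_real (2 * cos (\<alpha> / 2))"
    by (simp add: complex_eq_iff)
  ultimately have "1 + cis \<alpha> = cis (\<alpha> / 2) * of_real (2 * cos (\<alpha> / 2))"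
    by (metis add.commute distrib_left)
  thus ?thesis by (simp add: norm_mult norm_divide)
qed

lemma cos_of_nat_mult_le:
  fixes \<theta> :: real
  assumes "0 \<le> \<theta>" "real j * \<theta> \<le> pi / 2"
  shows "cos (real j * \<theta>) \<le> cos \<theta> ^ j"
  using assms(2)
proof (induction j)
  case (Suc j)
  have le: "real j * \<theta> \<le> pi / 2" using Suc.prems assms(1) by (simp add: algebra_simps)
  have le': "\<theta> \<le> pi / 2"
    using Suc.prems assms(1) mult_nonneg_nonneg[of "real j" \<theta>]
    unfolding of_nat_Suc distrib_right by linarith
  have "0 \<le> real j * \<theta>" using assms(1) by simp
  hence "sin (real j * \<theta>) \<ge> 0" "sin \<theta> \<ge> 0" "cos \<theta> \<ge> 0"
    using le le' assms(1) by (auto intro!: sin_ge_zero cos_ge_zero)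
  hence "cos (real (Suc j) * \<theta>) \<le> cos (real j * \<theta>) * cos \<theta>"
    by (simp add: distrib_right cos_add add.commute[of \<theta>])
  also have "\<dots> \<le> cos \<theta> ^ j * cos \<theta>"
    using Suc.IH[OF le] \<open>cos \<theta> \<ge> 0\<close> by (rule mult_right_mono)
  finally show ?case by (simp add: mult_ac)
qed simp

lemma cos_double_le_power4: "cos (2 * \<theta>) \<le> cos \<theta> ^ 4" for \<theta> :: real
proof -
  have "0 \<le> (cos \<theta> ^ 2 - 1) ^ 2" by simp
  hence "2 * cos \<theta> ^ 2 - 1 \<le> cos \<theta> ^ 4"
    by (simp add: power2_eq_square power4_eq_xxxx algebra_simps)
  thus ?thesis by (simp only: cos_double_cos)
qed

lemma abs_cos_reflect:
  assumes "j \<le> q" "q > 0"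
  shows "\<bar>cos (pi * real (q - j) / real q)\<bar> = \<bar>cos (pi * real j / real q)\<bar>"
proof -
  have "pi * real (q - j) / real q = pi - pi * real j / real q"
    using assms by (simp add: of_nat_diff field_simps)
  thus ?thesis by (simp only: cos_pi_minus abs_minus_cancel)
qed

lemma abs_cos_le_power:
  assumes "2 * j \<le> q" "q > 0"
  shows "\<bar>cos (pi * real j / real q)\<bar> \<le> cos (pi / real q) ^ j"
proof -
  have le: "real j * (pi / real q) \<le> pi / 2"
  proof -
    have "real (2 * j) \<le> real q" using assms(1) by (simp only: of_nat_le_iff)
    thus ?thesis using assms(2) by (simp add: field_simps)
  qed
  have "0 \<le> cos (real j * (pi / real q))"
    by (rule cos_ge_zero) (use le in \<open>auto intro: order.trans[of _ 0]\<close>)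
  moreover have "cos (real j * (pi / real q)) \<le> cos (pi / real q) ^ j"
    by (rule cos_of_nat_mult_le) (use le in auto)
  ultimately show ?thesis by (simp add: mult.commute)
qed

text \<open>Frequency 0 contributes 1. The others are bounded by two geometric series of ratio at
  most 1/2, one from each end of the range, each of sum at most 1.\<close>

lemma sum_abs_cos_power_le:
  fixes q n :: nat
  assumes "q \<ge> 2" and x: "cos (pi / real q) ^ n \<le> 1 / 2"
  shows "(\<Sum>j<q. \<bar>cos (pi * real j / real q)\<bar> ^ n) \<le> 3"
proof -
  define x where "x = cos (pi / real q) ^ n"
  have "pi / real q \<le> pi / 2" using assms(1) by (intro divide_left_mono) auto
  hence c: "0 \<le> cos (pi / real q)"
    by (intro cos_ge_zero) (auto intro: order.trans[of _ 0])
  hence x: "0 \<le> x" "x \<le> 1 / 2" using assms(2) by (auto simp: x_def)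
  have half: "\<bar>cos (pi * real j / real q)\<bar> ^ n \<le> x ^ j" if "2 * j \<le> q" for j
    using power_mono[OF abs_cos_le_power[of j q], of n] that assms(1)
    by (simp add: x_def power_mult[symmetric] mult.commute)
  \<comment> \<open>Adding the bounds for \<open>j\<close> and for its reflection
    \<open>q - j\<close> gives one estimate valid in both halves of the range.\<close>
  have term_le: "\<bar>cos (pi * real j / real q)\<bar> ^ n \<le> x ^ j + x ^ (q - j)" if "j < q" for j
  proof (cases "2 * j \<le> q")
    case True
    thus ?thesis using half[of j] x by (simp add: add_increasing2)
  next
    case False
    thus ?thesis using half[of "q - j"] abs_cos_reflect[of j q] that x
      by (simp add: add_increasing)
  qed
  have geom: "(\<Sum>j\<in>{1..<q}. x ^ j) \<le> 1"
  proof -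
    have "(\<Sum>j\<in>{1..<q}. x ^ j) \<le> (\<Sum>j\<in>{1..<q}. (1 / 2) ^ j)"
      using x by (intro sum_mono power_mono) auto
    also have "\<dots> = 1 - 2 * (1 / 2) ^ q"
      using assms(1) by (induction q rule: dec_induct) (auto simp: numeral_2_eq_2)
    finally show ?thesis by (smt (verit) zero_le_power divide_nonneg_nonneg)
  qed
  have "{..<q} = insert 0 {1..<q}" using assms(1) by auto
  hence "(\<Sum>j<q. \<bar>cos (pi * real j / real q)\<bar> ^ n)
      = 1 + (\<Sum>j\<in>{1..<q}. \<bar>cos (pi * real j / real q)\<bar> ^ n)"
    by simp
  also have "(\<Sum>j\<in>{1..<q}. \<bar>cos (pi * real j / real q)\<bar> ^ n)
      \<le> (\<Sum>j\<in>{1..<q}. x ^ j + x ^ (q - j))"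
    by (intro sum_mono term_le) auto
  also have "\<dots> = (\<Sum>j\<in>{1..<q}. x ^ j) + (\<Sum>j\<in>{1..<q}. x ^ (q - j))"
    by (rule sum.distrib)
  also have "(\<Sum>j\<in>{1..<q}. x ^ (q - j)) = (\<Sum>j\<in>{1..<q}. x ^ j)"
    by (rule sum.reindex_bij_witness[of _ "\<lambda>j. q - j" "\<lambda>j. q - j"]) auto
  finally show ?thesis using geom by linarith
qed

section \<open>Characters of the residues modulo \<open>q\<close> and Fourier inversion\<close>

lemma cis_power_eq_1_iff:
  assumes "q > 0"
  shows "cis (2 * pi / real q) ^ k = 1 \<longleftrightarrow> q dvd k"
proof -
  have "cis (2 * pi / real q) ^ k = exp (2 * of_real pi * \<i> * of_nat k / of_nat q)"
    unfolding Complex.DeMoivre by (simp add: cis_conv_exp field_simps)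
  thus ?thesis using complex_root_unity_eq_1[of q k] assms by simp
qed

lemma cis_power_mod:
  assumes "q > 0"
  shows "cis (2 * pi / real q) ^ (k mod q) = cis (2 * pi / real q) ^ k"
proof -
  have "cis (2 * pi / real q) ^ k = cis (2 * pi / real q) ^ (q * (k div q) + k mod q)" by simp
  also have "\<dots> = (cis (2 * pi / real q) ^ q) ^ (k div q) * cis (2 * pi / real q) ^ (k mod q)"
    by (simp only: power_add power_mult)
  finally show ?thesis using cis_power_eq_1_iff[OF assms, of q] by simp
qed

lemma sum_cis_powers:
  assumes "q > 0"
  shows "(\<Sum>j<q. (cis (2 * pi / real q) ^ j) ^ k) = (if q dvd k then of_nat q else 0)"
proof -
  let ?z = "cis (2 * pi / real q) ^ k"
  have "?z ^ q = (cis (2 * pi / real q) ^ q) ^ k" by (simp add: power_mult[symmetric] mult.commute)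
  hence "?z ^ q = 1" using cis_power_eq_1_iff[OF assms, of q] by simp
  have "(\<Sum>j<q. (cis (2 * pi / real q) ^ j) ^ k) = (\<Sum>j<q. ?z ^ j)"
    by (simp add: power_mult[symmetric] mult.commute)
  also have "\<dots> = (if q dvd k then of_nat q else 0)"
    using cis_power_eq_1_iff[OF assms, of k] geometric_sum[of ?z q] \<open>?z ^ q = 1\<close> by auto
  finally show ?thesis .
qed

text \<open>Fourier inversion at \<open>r\<close>, followed by the triangle inequality.\<close>

lemma pmf_le_sum_norm_characters:
  fixes X :: "nat pmf"
  assumes "set_pmf X \<subseteq> {..<q}" "r < q"
  shows "real q * pmf X r
    \<le> (\<Sum>j<q. norm (measure_pmf.expectation X (\<lambda>x. (cis (2 * pi / real q) ^ j) ^ x)))"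
proof -
  define \<omega> where "\<omega> = cis (2 * pi / real q)"
  have q: "q > 0" using assms(2) by simp
  \<comment> \<open>The exponent \<open>q - r\<close> stands for \<open>- r\<close>, which keeps it
    natural. As \<open>(q - r) + x\<close> lies strictly between 0 and \<open>2 * q\<close>, it is a
    multiple of \<open>q\<close> only if it equals \<open>q\<close>.\<close>
  have orth: "(\<Sum>j<q. (\<omega> ^ j) ^ (q - r) * (\<omega> ^ j) ^ x) = (if x = r then of_nat q else 0)"
    if "x < q" for x
  proof -
    have "q dvd (q - r) + x \<longleftrightarrow> x = r"
    proof
      assume "q dvd (q - r) + x"
      then obtain t where t: "(q - r) + x = q * t" by (elim dvdE)
      have "0 < q * t" "q * t < q * 2" using t that assms(2) by linarith+
      hence "t = 1" by simp
      thus "x = r" using t assms(2) by simp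
    qed (use assms(2) in simp)
    thus ?thesis
      using sum_cis_powers[OF q, of "(q - r) + x"] by (simp add: \<omega>_def power_add)
  qed
  have E: "measure_pmf.expectation X (\<lambda>x. (\<omega> ^ j) ^ x) = (\<Sum>x<q. of_real (pmf X x) * (\<omega> ^ j) ^ x)" for j
    using assms(1) by (subst integral_measure_pmf[of "{..<q}"]) (auto simp: scaleR_conv_of_real)
  have "(\<Sum>j<q. (\<omega> ^ j) ^ (q - r) * measure_pmf.expectation X (\<lambda>x. (\<omega> ^ j) ^ x))
      = (\<Sum>x<q. of_real (pmf X x) * (\<Sum>j<q. (\<omega> ^ j) ^ (q - r) * (\<omega> ^ j) ^ x))"
    unfolding E sum_distrib_left by (subst sum.swap) (simp add: mult_ac)
  also have "\<dots> = (\<Sum>x<q. if x = r then of_real (pmf X x) * of_nat q else 0)"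
    by (intro sum.cong refl) (simp add: orth)
  also have "\<dots> = of_real (real q * pmf X r)"
    using assms(2) by (simp add: mult.commute)
  finally have "real q * pmf X r
      = norm (\<Sum>j<q. (\<omega> ^ j) ^ (q - r) * measure_pmf.expectation X (\<lambda>x. (\<omega> ^ j) ^ x))"
    by (simp add: norm_mult del: of_real_mult)
  also have "\<dots> \<le> (\<Sum>j<q. norm (measure_pmf.expectation X (\<lambda>x. (\<omega> ^ j) ^ x)))"
    by (intro sum_norm_le) (simp add: norm_mult norm_power \<omega>_def)
  finally show ?thesis unfolding \<omega>_def .
qed

text \<open>Padding with zero parameters makes this the law of \<open>a \<cdot> Bin(n, 1/2) mod q\<close> for every
  \<open>N \<ge> n\<close>.\<close>

definition dilated_binomial :: "nat \<Rightarrow> nat \<Rightarrow> nat \<Rightarrow> nat \<Rightarrow> nat pmf" where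
  "dilated_binomial q n N a =
     map_pmf (\<lambda>s. (a * s) mod q) (pbd (\<lambda>i. if i < n then 1 / 2 else 0) N)"

lemma set_pmf_dilated_binomial: "q > 0 \<Longrightarrow> set_pmf (dilated_binomial q n N a) \<subseteq> {..<q}"
  by (auto simp: dilated_binomial_def)

text \<open>Dilation by \<open>a\<close> moves the frequency \<open>j\<close> to
  \<open>j * a mod q\<close>. There each fair coin contributes a factor of modulus given by
  \<open>norm_one_plus_cis\<close>, and the padding contributes factors 1.\<close>

lemma norm_character_dilated_binomial:
  assumes "q > 0" "n \<le> N"
  shows "norm (measure_pmf.expectation (dilated_binomial q n N a) (\<lambda>x. (cis (2 * pi / real q) ^ j) ^ x))
    = \<bar>cos (pi * real (j * a mod q) / real q)\<bar> ^ n"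
proof -
  define \<omega> where "\<omega> = cis (2 * pi / real q)"
  have "(\<omega> ^ j) ^ (a * s mod q) = (\<omega> ^ (j * a mod q)) ^ s" for s
  proof -
    have "(\<omega> ^ j) ^ (a * s mod q) = \<omega> ^ (j * (a * s mod q) mod q)"
      by (simp add: \<omega>_def cis_power_mod[OF assms(1)] power_mult)
    also have "j * (a * s mod q) mod q = (j * a mod q) * s mod q" by (simp add: mod_simps mult_ac)
    finally show ?thesis by (simp add: \<omega>_def cis_power_mod[OF assms(1)] power_mult)
  qed
  hence "measure_pmf.expectation (dilated_binomial q n N a) (\<lambda>x. (\<omega> ^ j) ^ x)
      = measure_pmf.expectation (pbd (\<lambda>i. if i < n then 1 / 2 else 0) N) (\<lambda>s. (\<omega> ^ (j * a mod q)) ^ s)"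
    by (simp add: dilated_binomial_def)
  also have "\<dots> = (\<Prod>i<N. if i < n then (1 + \<omega> ^ (j * a mod q)) / 2 else 1)"
    by (subst expectation_pbd_power) (auto intro!: prod.cong simp: field_simps)
  also have "\<dots> = (\<Prod>i\<in>{..<N} \<inter> {i. i < n}. (1 + \<omega> ^ (j * a mod q)) / 2)"
    by (subst prod.If_cases) auto
  also have "{..<N} \<inter> {i. i < n} = {..<n}" using assms(2) by auto
  finally have "norm (measure_pmf.expectation (dilated_binomial q n N a) (\<lambda>x. (\<omega> ^ j) ^ x))
      = norm ((1 + \<omega> ^ (j * a mod q)) / 2) ^ n"
    by (simp add: norm_power norm_divide power_divide)
  also have "norm ((1 + \<omega> ^ (j * a mod q)) / 2) = \<bar>cos (pi * real (j * a mod q) / real q)\<bar>"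
    unfolding \<omega>_def Complex.DeMoivre norm_one_plus_cis by (simp add: field_simps)
  finally show ?thesis unfolding \<omega>_def .
qed

lemma mult_mod_inj:
  fixes a q :: nat
  assumes "coprime a q" "q > 0"
  shows "inj_on (\<lambda>j. j * a mod q) {..<q}"
  using assms cong_mult_rcancel_nat[of a q]
  by (auto simp: inj_on_def cong_def)

text \<open>Multiplication by a unit permutes the frequencies, so the sum of the moduli of the
  coefficients does not depend on \<open>a\<close>.\<close>

lemma pmf_dilated_binomial_le:
  assumes "q \<ge> 2" "n \<le> N" "coprime a q" "cos (pi / real q) ^ n \<le> 1 / 2"
  shows "pmf (dilated_binomial q n N a) r \<le> 3 * pmf (pmf_of_set {..<q}) r"
proof (cases "r < q")
  case True
  have q: "q > 0" using assms(1) by simp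
  have "(\<lambda>j. j * a mod q) ` {..<q} = {..<q}"
    using mult_mod_inj[OF assms(3) q] q by (intro endo_inj_surj) auto
  hence bij: "bij_betw (\<lambda>j. j * a mod q) {..<q} {..<q}"
    using mult_mod_inj[OF assms(3) q] by (simp add: bij_betw_def)
  have "real q * pmf (dilated_binomial q n N a) r
      \<le> (\<Sum>j<q. \<bar>cos (pi * real (j * a mod q) / real q)\<bar> ^ n)"
    using pmf_le_sum_norm_characters[OF set_pmf_dilated_binomial[OF q] True, of n N a]
    by (simp add: norm_character_dilated_binomial[OF q assms(2)])
  also have "\<dots> = (\<Sum>j<q. \<bar>cos (pi * real j / real q)\<bar> ^ n)"
    by (rule sum.reindex_bij_betw[OF bij])
  also have "\<dots> \<le> 3" using assms by (intro sum_abs_cos_power_le)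
  finally show ?thesis using True q by (simp add: pmf_of_set lessThan_empty_iff field_simps)
next
  case False
  hence "r \<notin> set_pmf (dilated_binomial q n N a)"
    using set_pmf_dilated_binomial[of q n N a] assms(1) by auto
  thus ?thesis by (simp add: set_pmf_iff)
qed

lemma dTV_dilated_binomial_ge:
  assumes "prime q" "n \<le> N" and x: "1 / 4 \<le> cos (pi / real q) ^ n" "cos (pi / real q) ^ n \<le> 1 / 2"
    and a: "a \<in> {1..(q - 1) div 2}" and b: "b \<in> {1..(q - 1) div 2}" and "a \<noteq> b"
  shows "1 / 10 \<le> dTV (dilated_binomial q n N a) (dilated_binomial q n N b)"
proof -
  define x where "x = cos (pi / real q) ^ n"
  have q: "q \<ge> 2" using assms(1) by (rule prime_ge_2_nat)
  have ab: "0 < a" "0 < b" "a < q" "b < q" "a + b < q" using a b q by auto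
  have "coprime a q"
    using assms(1) ab by (metis coprime_commute nat_dvd_not_less prime_imp_coprime)
  then obtain j where "[a * j = 1] (mod q)" using cong_solve_coprime_nat by auto
  hence ja: "j * a mod q = 1" using q by (simp add: cong_def mult.commute)
  \<comment> \<open>\<open>t\<close> represents \<open>b / a\<close> modulo \<open>q\<close>. It is
    neither 0 nor 1, and \<open>t = q - 1\<close> would make \<open>q\<close> divide
    \<open>a + b\<close>, which is excluded since \<open>a\<close> and \<open>b\<close> lie in the
    lower half.\<close>
  define t where "t = j * b mod q"
  have ta: "t * a mod q = b"
  proof -
    have "t * a mod q = (j * a mod q) * b mod q" unfolding t_def by (simp add: mod_simps mult_ac)
    thus ?thesis using ja ab by simp
  qed
  have "t \<noteq> 0" using ta ab by (intro notI) simp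
  moreover have "t \<noteq> 1" using ta ab \<open>a \<noteq> b\<close> by auto
  moreover have "t \<noteq> q - 1"
  proof
    assume t: "t = q - 1"
    have "(b + a) mod q = (t * a + a) mod q" using ta by (metis mod_add_left_eq)
    also have "t * a + a = Suc t * a" by simp
    also have "Suc t = q" using t q by simp
    finally show False using ab by simp
  qed
  moreover have "t < q" using q by (simp add: t_def)
  ultimately have t: "2 \<le> t" "2 \<le> q - t" "t < q" by auto
  have c: "0 \<le> cos (pi / real q)"
    using q by (intro cos_ge_zero) (auto intro: order.trans[of _ 0] simp: field_simps)
  \<comment> \<open>By reflection only \<open>2 \<le> t \<le> q / 2\<close> matters, where the
    cosine is largest at \<open>t = 2\<close>.\<close>
  have cos_t: "\<bar>cos (pi * real t / real q)\<bar> \<le> cos (pi / real q) ^ 4"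
  proof -
    have *: "\<bar>cos (pi * real s / real q)\<bar> \<le> cos (pi / real q) ^ 4" if "2 \<le> s" "2 * s \<le> q" for s
    proof -
      have "real (2 * s) \<le> real q" using that(2) by (simp only: of_nat_le_iff)
      hence le: "pi * real s / real q \<le> pi / 2" using q by (simp add: field_simps)
      have "0 \<le> cos (pi * real s / real q)"
        using le by (intro cos_ge_zero) (auto intro: order.trans[of _ 0])
      moreover have "cos (pi * real s / real q) \<le> cos (2 * (pi / real q))"
        using le that q by (intro cos_monotone_0_pi_le) (auto simp: field_simps)
      ultimately show ?thesis using cos_double_le_power4[of "pi / real q"] by linarith
    qed
    show ?thesis
    proof (cases "2 * t \<le> q")
      case False
      thus ?thesis using *[of "q - t"] t abs_cos_reflect[of t q] by simp
    qed (use * t in auto)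
  qed
  let ?E = "\<lambda>a. measure_pmf.expectation (dilated_binomial q n N a) (\<lambda>x. (cis (2 * pi / real q) ^ j) ^ x)"
  have "norm (?E a) = x"
    using norm_character_dilated_binomial[of q n N a j] q assms(2) c ja by (simp add: x_def)
  moreover have "norm (?E b) \<le> x ^ 4"
    using norm_character_dilated_binomial[of q n N b j] q assms(2) power_mono[OF cos_t, of n]
    by (simp add: x_def t_def power_mult[symmetric] mult.commute)
  \<comment> \<open>Hence the coefficients differ by at least \<open>7 * x / 8\<close>, which is at
    least 7/32; half of this, 7/64, exceeds 1/10.\<close>
  moreover have "x ^ 4 \<le> x / 8"
  proof -
    have "x ^ 3 \<le> (1 / 2) ^ 3" using assms by (intro power_mono) (auto simp: x_def)
    hence "x * x ^ 3 \<le> x * (1 / 8)" using assms by (intro mult_left_mono) (auto simp: x_def power3_eq_cube)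
    thus ?thesis by (simp add: power_numeral_reduce)
  qed
  moreover have "norm (?E a - ?E b) \<le> 2 * dTV (dilated_binomial q n N a) (dilated_binomial q n N b)"
    using q by (intro norm_expectation_diff_le_dTV[of "{..<q}"] set_pmf_dilated_binomial)
      (auto simp: norm_power)
  moreover have "x \<ge> 1 / 4" using x by (simp add: x_def)
  ultimately show ?thesis using norm_triangle_ineq2[of "?E a" "?E b"] by linarith
qed

text \<open>At the first power not above 1/2, the preceding one exceeds 1/2, and one more factor
  \<open>c\<close> at most halves it.\<close>

lemma exists_power_in_quarter_half:
  fixes c :: real
  assumes "1 / 2 \<le> c" "c < 1"
  shows "\<exists>n. 1 / 4 \<le> c ^ n \<and> c ^ n \<le> 1 / 2"
proof -
  obtain n0 where "c ^ n0 < 1 / 2" using real_arch_pow_inv[of "1 / 2" c] assms by auto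
  hence ex: "c ^ n0 \<le> 1 / 2" by simp
  define n where "n = (LEAST n. c ^ n \<le> 1 / 2)"
  have n: "c ^ n \<le> 1 / 2" unfolding n_def using ex by (rule LeastI)
  then obtain k where k: "n = Suc k" by (cases n) auto
  have "\<not> c ^ k \<le> 1 / 2" by (rule not_less_Least) (use k in \<open>simp add: n_def\<close>)
  hence "1 / 2 * (1 / 2) \<le> c * c ^ k" using assms by (intro mult_mono) auto
  thus ?thesis using n by (intro exI[of _ n]) (simp add: k)
qed

section \<open>The sample complexity bound\<close>

lemma learning_lower_bound_prime:
  fixes q :: nat
  assumes q: "prime q" "q \<ge> 64"
  shows "\<exists>N0. \<forall>N\<ge>N0. \<forall>m (A :: nat list \<Rightarrow> nat pmf pmf).
    (\<forall>(p::nat \<Rightarrow> real) (a2::nat).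
       (\<forall>i. 0 \<le> p i \<and> p i \<le> 1) \<longrightarrow> a2 \<in> {1..<q} \<longrightarrow>
       (let S' = map_pmf (\<lambda>s. (a2 * s) mod q) (pbd p N)
        in measure_pmf.expectation (bind_pmf (iid_samples m S') A) (\<lambda>H. dTV S' H) \<le> 1 / 40))
    \<longrightarrow> ln (real q) \<le> 4 * real m"
proof -
  \<comment> \<open>\<open>cos (pi / 3)\<close> is 1/2, the lower bound required for finding the
    exponent \<open>n\<close>.\<close>
  have "cos (pi / 3) \<le> cos (pi / real q)"
    using q by (intro cos_monotone_0_pi_le) (auto simp: field_simps)
  moreover have "cos (pi / real q) < cos 0"
    using q by (intro cos_monotone_0_pi) (auto simp: field_simps)
  ultimately obtain n where n: "1 / 4 \<le> cos (pi / real q) ^ n" "cos (pi / real q) ^ n \<le> 1 / 2"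
    using exists_power_in_quarter_half[of "cos (pi / real q)"] by (auto simp: cos_60)
  show ?thesis
  proof (intro exI[of _ n] allI impI)
    fix N m :: nat and A :: "nat list \<Rightarrow> nat pmf pmf"
    assume N: "n \<le> N"
    assume *: "\<forall>(p::nat \<Rightarrow> real) (a2::nat).
       (\<forall>i. 0 \<le> p i \<and> p i \<le> 1) \<longrightarrow> a2 \<in> {1..<q} \<longrightarrow>
       (let S' = map_pmf (\<lambda>s. (a2 * s) mod q) (pbd p N)
        in measure_pmf.expectation (bind_pmf (iid_samples m S') A) (\<lambda>H. dTV S' H) \<le> 1 / 40)"
    let ?I = "{1..(q - 1) div 2}"
    have "real (card ?I) \<le> 2 * 3 ^ m"
    proof (rule card_separated_family_le[where \<delta> = "1 / 10" and D = "dilated_binomial q n N"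
          and Q = "pmf_of_set {..<q}" and A = A])
      show "pmf (dilated_binomial q n N a) r \<le> 3 * pmf (pmf_of_set {..<q}) r" if "a \<in> ?I" for a r
      proof (rule pmf_dilated_binomial_le)
        have "\<not> q dvd a" using that q by (auto dest: dvd_imp_le)
        thus "coprime a q" using prime_imp_coprime[OF q(1)] by (simp add: coprime_commute)
      qed (use q n N in auto)
      show "1 / 10 \<le> dTV (dilated_binomial q n N a) (dilated_binomial q n N b)"
        if "a \<in> ?I" "b \<in> ?I" "a \<noteq> b" for a b
        using that q n N by (intro dTV_dilated_binomial_ge)
      show "measure_pmf.expectation (bind_pmf (iid_samples m (dilated_binomial q n N a)) A)
          (dTV (dilated_binomial q n N a)) \<le> 1 / 10 / 4" if "a \<in> ?I" for a
        using *[rule_format, of "\<lambda>i. if i < n then 1 / 2 else 0" a] that q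
        by (auto simp: dilated_binomial_def Let_def)
    qed auto
    \<comment> \<open>The dilations up to \<open>(q - 1) div 2\<close> still number at least a
      quarter of \<open>q\<close>.\<close>
    moreover have "real q \<le> 4 * real (card ?I)" using q by simp
    ultimately have "real q \<le> 8 * 3 ^ m" by linarith
    \<comment> \<open>For \<open>q \<ge> 64\<close> the constant 8 is absorbed by passing from
      \<open>q\<close> to its square root.\<close>
    have "sqrt (real q) * 8 \<le> sqrt (real q) * sqrt (real q)"
      using q by (intro mult_left_mono real_le_rsqrt) auto
    hence "8 * sqrt (real q) \<le> real q" by simp
    hence "sqrt (real q) \<le> 3 ^ m" using \<open>real q \<le> 8 * 3 ^ m\<close> by linarith
    hence "ln (sqrt (real q)) \<le> ln (3 ^ m)" using q by (subst ln_le_cancel_iff) auto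
    hence "ln (real q) \<le> 2 * (real m * ln 3)" using q by (simp add: ln_sqrt ln_realpow)
    also have "\<dots> \<le> 2 * (real m * 2)" using ln_le_minus_one[of 3] by (intro mult_left_mono) auto
    finally show "ln (real q) \<le> 4 * real m" by simp
  qed
qed

text \<open>The outer \<open>pmf\<close> in \<open>nat pmf pmf\<close> is the learner's internal
  randomness. \<open>A\<close> is quantified after \<open>a_max\<close> and \<open>N\<close>, so it
  may depend on both, and \<open>N0\<close> may depend on \<open>a_max\<close>.\<close>

theorem theorem66:
  shows "\<exists>\<epsilon>0::real. \<epsilon>0 > 0 \<and> (\<exists>c::real. c > 0 \<and> (\<exists>A0::nat. \<forall>a_max::nat. a_max \<ge> A0 \<longrightarrow>
     (\<exists>N0::nat. \<forall>N::nat. N \<ge> N0 \<longrightarrow>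
       (\<forall>(m::nat) (A :: nat list \<Rightarrow> nat pmf pmf).
          (\<forall>(p::nat \<Rightarrow> real) (a2::nat).
             (\<forall>i. 0 \<le> p i \<and> p i \<le> 1) \<longrightarrow> a2 \<in> {1..<largest_prime_le a_max} \<longrightarrow>
             (let S' = map_pmf (\<lambda>s. (a2 * s) mod largest_prime_le a_max) (pbd p N)
              in measure_pmf.expectation (bind_pmf (iid_samples m S') A) (\<lambda>H. dTV S' H) \<le> \<epsilon>0))
          \<longrightarrow> real m \<ge> c * ln (real a_max)))))"
proof -
  obtain A0 where A0: "\<And>n. n \<ge> A0 \<Longrightarrow> sqrt (real n) \<le> real (largest_prime_le n)"
    using eventually_sqrt_le_largest_prime_le by (auto simp: eventually_at_top_linorder)
  \<comment> \<open>1/40 is a quarter of the separation 1/10; 1/8 combines the factor 1/4 for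
    \<open>q\<close> with the loss of 1/2 from \<open>q \<ge> sqrt a_max\<close>; and 4096 is the
    square of 64.\<close>
  show ?thesis
  proof (rule exI[of _ "1 / 40"], rule conjI, simp, rule exI[of _ "1 / 8"], rule conjI, simp,
      rule exI[of _ "max A0 4096"], intro allI impI)
    fix a_max :: nat
    assume "max A0 4096 \<le> a_max"
    define q where "q = largest_prime_le a_max"
    have sqrt_le: "sqrt (real a_max) \<le> real q" using A0 \<open>max A0 4096 \<le> a_max\<close> by (simp add: q_def)
    have "sqrt (64 ^ 2) \<le> sqrt (real a_max)"
      using \<open>max A0 4096 \<le> a_max\<close> by (subst real_sqrt_le_iff) simp
    hence "64 \<le> real q" using sqrt_le by simp
    hence "q \<ge> 64" by simp
    moreover have "prime q"
      unfolding q_def using \<open>max A0 4096 \<le> a_max\<close> by (intro largest_prime_le_props) simp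
    moreover have "1 / 8 * ln (real a_max) \<le> real m" if "ln (real q) \<le> 4 * real m" for m
    proof -
      have "ln (real a_max) / 2 = ln (sqrt (real a_max))"
        using \<open>max A0 4096 \<le> a_max\<close> by (simp add: ln_sqrt)
      also have "\<dots> \<le> ln (real q)"
        using sqrt_le \<open>max A0 4096 \<le> a_max\<close> \<open>q \<ge> 64\<close> by (subst ln_le_cancel_iff) auto
      finally show ?thesis using that by simp
    qed
    ultimately show "\<exists>N0. \<forall>N\<ge>N0. \<forall>m (A :: nat list \<Rightarrow> nat pmf pmf).
          (\<forall>(p::nat \<Rightarrow> real) (a2::nat).
             (\<forall>i. 0 \<le> p i \<and> p i \<le> 1) \<longrightarrow> a2 \<in> {1..<largest_prime_le a_max} \<longrightarrow>
             (let S' = map_pmf (\<lambda>s. (a2 * s) mod largest_prime_le a_max) (pbd p N)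
              in measure_pmf.expectation (bind_pmf (iid_samples m S') A) (\<lambda>H. dTV S' H) \<le> 1 / 40))
          \<longrightarrow> real m \<ge> 1 / 8 * ln (real a_max)"
      using learning_lower_bound_prime[of q] unfolding q_def[symmetric] by meson
  qed
qed

end
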